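(* Let $V$ be a finite-dimensional vector space over a field $\mathbb{F}$ with $\dim V\geq 4$. Let $\mathbb{L}$ and $\mathbb{L}'$ be two quadratic extensions of $\mathbb{F}$ inside $\mathrm{End}(V)$ such that $W_{\mathbb{L}}=W_{\mathbb{L}'}$. Then $\mathbb{L}=\mathbb{L}'$.
   Context: A quadratic extension of $\mathbb{F}$ inside $\mathrm{End}(V)$ is a subalgebra of $\mathrm{End}(V)$ containing $\mathbb{F}\,\mathrm{id}_V$ (identified with $\mathbb{F}$) that is a field of degree $2$ over $\mathbb{F}$ (its existence forces $\dim V$ to be even). For such $\mathbb{L}$, $W_{\mathbb{L}}$ denotes the set of all bilinear forms $s:V^2\to\mathbb{F}$ such that $s(x,\lambda(x))=0$ for all $x\in V$ and all $\lambda\in\mathbb{L}$. *)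

theory Defs
  imports Complex_Main "HOL-Algebra.Embedded_Algebras"
begin

text \<open>
  The vector space \<open>V\<close> is a whole type \<open>'v\<close>, with scalar multiplication \<open>scale\<close> over
  the field \<open>'f\<close>, in the sense of \<open>HOL.Vector_Spaces\<close>.
\<close>

definition End_ring :: "('f::field \<Rightarrow> 'v::ab_group_add \<Rightarrow> 'v) \<Rightarrow> ('v \<Rightarrow> 'v) ring" where
  "End_ring scale =
     \<lparr>carrier = {f. Vector_Spaces.linear scale scale f},
      mult = (\<circ>),
      one = id,
      zero = (\<lambda>x. 0),
      add = (\<lambda>f g x. f x + g x)\<rparr>"

lemma End_ring_simps:
  "carrier (End_ring scale) = {f. Vector_Spaces.linear scale scale f}"
  "f \<otimes>\<^bsub>End_ring scale\<^esub> g = f \<circ> g"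
  "\<one>\<^bsub>End_ring scale\<^esub> = id"
  "\<zero>\<^bsub>End_ring scale\<^esub> = (\<lambda>x. 0)"
  "f \<oplus>\<^bsub>End_ring scale\<^esub> g = (\<lambda>x. f x + g x)"
  by (simp_all add: End_ring_def)

lemma linear_endo_iff:
  assumes "vector_space scale"
  shows "Vector_Spaces.linear scale scale f \<longleftrightarrow>
    (\<forall>x y. f (x + y) = f x + f y) \<and> (\<forall>c x. f (scale c x) = scale c (f x))"
  using assms
  by (auto simp: linear_iff_module_hom module_hom_iff module_iff_vector_space)

lemma ring_End_ring:
  assumes "vector_space scale"
  shows "ring (End_ring scale)"
proof -
  interpret vector_space scale by fact
  note lin = linear_endo_iff[OF assms]
  show ?thesis
  proof (rule ringI)
    show "abelian_group (End_ring scale)"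
    proof (rule abelian_groupI)
      fix f assume f: "f \<in> carrier (End_ring scale)"
      show "\<exists>g\<in>carrier (End_ring scale). g \<oplus>\<^bsub>End_ring scale\<^esub> f = \<zero>\<^bsub>End_ring scale\<^esub>"
        using f by (intro bexI[of _ "\<lambda>x. - f x"]) (auto simp: End_ring_simps lin)
    qed (auto simp: End_ring_simps lin algebra_simps)
    show "Group.monoid (End_ring scale)"
      by unfold_locales (auto simp: End_ring_simps lin o_assoc)
  qed (auto simp: End_ring_simps lin fun_eq_iff)
qed

text \<open>The copy \<open>F id\<^sub>V\<close> of the ground field inside \<open>End(V)\<close>.\<close>

definition scalar_maps :: "('f::field \<Rightarrow> 'v::ab_group_add \<Rightarrow> 'v) \<Rightarrow> ('v \<Rightarrow> 'v) set" where
  "scalar_maps scale = range scale"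

text \<open>
  The library predicate \<^const>\<open>subalgebra\<close> only says that \<open>L\<close> is a linear subspace of
  \<open>End(V)\<close>; closure under composition and \<open>id \<in> L\<close> come from \<^const>\<open>subfield\<close>.
\<close>

definition quadratic_extension ::
    "('f::field \<Rightarrow> 'v::ab_group_add \<Rightarrow> 'v) \<Rightarrow> ('v \<Rightarrow> 'v) set \<Rightarrow> bool" where
  "quadratic_extension scale L \<longleftrightarrow>
     subalgebra (scalar_maps scale) L (End_ring scale) \<and>
     scalar_maps scale \<subseteq> L \<and>
     subfield L (End_ring scale) \<and>
     ring.dimension (End_ring scale) 2 (scalar_maps scale) L"

definition bilinear_form ::
    "('f::field \<Rightarrow> 'v::ab_group_add \<Rightarrow> 'v) \<Rightarrow> ('v \<Rightarrow> 'v \<Rightarrow> 'f) \<Rightarrow> bool" where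
  "bilinear_form scale s \<longleftrightarrow>
     (\<forall>x. Vector_Spaces.linear scale (*) (\<lambda>y. s x y)) \<and>
     (\<forall>y. Vector_Spaces.linear scale (*) (\<lambda>x. s x y))"

definition W_forms ::
    "('f::field \<Rightarrow> 'v::ab_group_add \<Rightarrow> 'v) \<Rightarrow> ('v \<Rightarrow> 'v) set \<Rightarrow> ('v \<Rightarrow> 'v \<Rightarrow> 'f) set" where
  "W_forms scale L = {s. bilinear_form scale s \<and> (\<forall>x. \<forall>l\<in>L. s x (l x) = 0)}"

end

theory Submission
  imports Defs
begin

text \<open>
  \<open>W\<^sub>L\<close> determines the lines \<open>L x\<close>: for \<open>x \<noteq> 0\<close> and \<open>y \<notin> L x\<close> some \<open>s \<in> W\<^sub>L\<close> has
  \<open>s x y \<noteq> 0\<close>. Hence equality of the two sets of forms gives \<open>f x \<in> L x\<close> for all \<open>f \<in> L'\<close> and all \<open>x\<close>.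
  Since \<open>V\<close> has dimension at least \<open>2\<close> over \<open>L\<close>, an additive map that preserves every
  \<open>L\<close>-line is multiplication by an element of \<open>L\<close>, so \<open>L' \<subseteq> L\<close>; conclude by symmetry.
\<close>

section \<open>Coordinates for a quadratic extension and the lines \<open>L x\<close>\<close>

text \<open>The extension in coordinates: id and a nonscalar generator \<open>a\<close> with trace
  \<open>t\<close> and norm \<open>n\<close>. The field structure enters through the quadratic
  relation \<open>a_a\<close> and through \<open>left_inverse\<close>.\<close>

locale quadratic_extension_generator = vector_space scale
  for scale :: "'f::field \<Rightarrow> 'v::ab_group_add \<Rightarrow> 'v" +
  fixes a :: "'v \<Rightarrow> 'v" and L :: "('v \<Rightarrow> 'v) set" and t n :: 'f
  assumes L_eq: "L = {\<lambda>x. scale c x + scale d (a x) |c d. True}"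
    and a_add: "a (x + y) = a x + a y"
    and a_scale: "a (scale c x) = scale c (a x)"
    and not_scalar: "a \<notin> scalar_maps scale"
    and a_a: "a (a x) = scale t (a x) - scale n x"
    and left_inverse: "l \<in> L \<Longrightarrow> l \<noteq> (\<lambda>x. 0) \<Longrightarrow> \<exists>m\<in>L. \<forall>x. m (l x) = x"
begin

lemma a_zero: "a 0 = 0"
  using a_scale[of 0 0] by simp

lemma a_minus: "a (- x) = - a x"
  using a_scale[of "-1" x] by simp

lemma a_diff: "a (x - y) = a x - a y"
  using a_add[of x "- y"] by (simp add: a_minus)

lemmas a_simps = a_zero a_minus a_diff a_add a_scale a_a

lemma L_I: "(\<lambda>x. scale c x + scale d (a x)) \<in> L"
  by (auto simp: L_eq)

lemma L_E:
  assumes "l \<in> L"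
  obtains c d where "l = (\<lambda>x. scale c x + scale d (a x))"
  using assms by (auto simp: L_eq)

lemma L_diff: "l \<in> L \<Longrightarrow> m \<in> L \<Longrightarrow> (\<lambda>x. l x - m x) \<in> L"
proof (elim L_E)
  fix c d c' d'
  assume *: "l = (\<lambda>x. scale c x + scale d (a x))" "m = (\<lambda>x. scale c' x + scale d' (a x))"
  have "(\<lambda>x. l x - m x) = (\<lambda>x. scale (c - c') x + scale (d - d') (a x))"
    by (simp add: * scale_left_diff_distrib fun_eq_iff)
  then show ?thesis by (simp add: L_I)
qed

lemma L_comp: "l \<in> L \<Longrightarrow> m \<in> L \<Longrightarrow> (\<lambda>x. l (m x)) \<in> L"
proof (elim L_E)
  fix c d c' d'
  assume *: "l = (\<lambda>x. scale c x + scale d (a x))" "m = (\<lambda>x. scale c' x + scale d' (a x))"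
  have "(\<lambda>x. l (m x)) =
      (\<lambda>x. scale (c * c' - d * d' * n) x + scale (c * d' + d * c' + d * d' * t) (a x))"
    by (simp add: * a_simps scale_right_distrib scale_left_distrib scale_left_diff_distrib
        scale_right_diff_distrib fun_eq_iff ac_simps)
  then show ?thesis by (simp add: L_I)
qed

lemma L_zero: "l \<in> L \<Longrightarrow> l 0 = 0"
  by (elim L_E) (simp add: a_zero)

lemma L_add: "l \<in> L \<Longrightarrow> l (x + y) = l x + l y"
  by (elim L_E) (simp add: a_add scale_right_distrib)

text \<open>A nonzero \<open>d\<close> could be divided out, making \<open>a\<close> the scalar map
  \<open>- c / d\<close>. Once \<open>d = 0\<close>, the nonzero vector \<open>x\<close> forces
  \<open>c = 0\<close>.\<close>

lemma coeffs_zero: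
  assumes "\<And>x. scale c x + scale d (a x) = 0" "(x :: 'v) \<noteq> 0"
  shows "c = 0" "d = 0"
proof -
  show "d = 0"
  proof (rule ccontr)
    assume "d \<noteq> 0"
    have "a x = scale (- c / d) x" for x
    proof -
      have "scale (inverse d) (scale c x + scale d (a x)) = 0"
        by (simp add: assms(1))
      with \<open>d \<noteq> 0\<close> show ?thesis
        by (simp add: scale_right_distrib divide_inverse mult.commute eq_neg_iff_add_eq_0 add.commute)
    qed
    then have "a = scale (- c / d)" by auto
    with not_scalar show False by (auto simp: scalar_maps_def)
  qed
  with assms show "c = 0" by force
qed

text \<open>If \<open>m\<close> is nonzero, applying its inverse to \<open>l x = m y\<close> puts
  \<open>y\<close> on the line \<open>L x\<close>. With \<open>m\<close> zero, a nonzero and hence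
  invertible \<open>l\<close> would send \<open>x\<close> to 0.\<close>

lemma line_independent:
  assumes "x \<noteq> 0" "y \<notin> (\<lambda>l. l x) ` L" "l \<in> L" "m \<in> L" "l x = m y"
  shows "l = (\<lambda>x. 0)" "m = (\<lambda>x. 0)"
proof -
  show m: "m = (\<lambda>x. 0)"
  proof (rule ccontr)
    assume "m \<noteq> (\<lambda>x. 0)"
    then obtain k where k: "k \<in> L" "\<And>x. k (m x) = x"
      using left_inverse assms(4) by blast
    have "y = k (l x)" using assms(5) k by simp
    with assms(2) L_comp[OF k(1) assms(3)] show False by (metis image_eqI)
  qed
  show "l = (\<lambda>x. 0)"
  proof (rule ccontr)
    assume "l \<noteq> (\<lambda>x. 0)"
    then obtain k where k: "k \<in> L" "\<And>x. k (l x) = x"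
      using left_inverse assms(3) by blast
    with assms(1,5) m L_zero show False by metis
  qed
qed

section \<open>Forms in \<open>W_forms scale L\<close> separating a vector from an
  \<open>L\<close>-line\<close>

lemma functional_separating:
  assumes "u \<notin> span S"
  obtains p where "Vector_Spaces.linear scale (*) p" "p u = 1" "\<And>v. v \<in> S \<Longrightarrow> p v = 0"
proof -
  interpret P: vector_space_pair scale "(*) :: 'f \<Rightarrow> 'f \<Rightarrow> 'f"
    by unfold_locales (auto simp: algebra_simps)
  obtain B where B: "B \<subseteq> S" "independent B" "S \<subseteq> span B"
    using maximal_independent_subset by blast
  have "span B = span S"
    using B span_mono span_minimal[of S "span B"] subspace_span by blast
  with assms have u: "u \<notin> span B" "u \<notin> B"
    by (auto intro: span_base)
  then have "independent (insert u B)"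
    using B(2) independent_insertI by blast
  then obtain p where p: "Vector_Spaces.linear scale (*) p"
      "\<forall>v\<in>insert u B. p v = (if v = u then 1 else 0)"
    using P.linear_independent_extend[of "insert u B" "\<lambda>v. if v = u then 1 else 0"] by blast
  have "p v = 0" if "v \<in> S" for v
  proof -
    have "p b = 0" if "b \<in> B" for b using p(2) u(2) that by auto
    from P.linear_eq_0_on_span[OF p(1) this] B(3) that show ?thesis by blast
  qed
  with p show ?thesis by (intro that[of p]) auto
qed

text \<open>If \<open>r\<close> is alternating and \<open>a\<^sup>2 = t a - n\<close>, then
  \<open>r u (a v) + r (a u) v - t * r u v\<close> lies in \<open>W\<^sub>L\<close>; here \<open>r\<close> is \<open>p \<and> q\<close>.\<close>

lemma wedge_in_W_forms:
  assumes p: "Vector_Spaces.linear scale (*) p" and q: "Vector_Spaces.linear scale (*) q"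
  defines "r \<equiv> \<lambda>u v. p u * q v - p v * q u"
  shows "(\<lambda>u v. r u (a v) + r (a u) v - t * r u v) \<in> W_forms scale L"
proof -
  have add: "p (x + y) = p x + p y" "q (x + y) = q x + q y"
    and mult: "p (scale c x) = c * p x" "q (scale c x) = c * q x" for x y c
    using p q by (auto simp: Vector_Spaces.linear_iff)
  have diff: "p (x - y) = p x - p y" "q (x - y) = q x - q y" for x y
    using add(1)[of "x - y" y] add(2)[of "x - y" y] by simp_all
  have r_add: "r (x + y) z = r x z + r y z" "r z (x + y) = r z x + r z y"
    and r_diff: "r (x - y) z = r x z - r y z" "r z (x - y) = r z x - r z y"
    and r_scale: "r (scale c x) z = c * r x z" "r z (scale c x) = c * r z x"
    and r_alt: "r x x = 0" and r_skew: "r x y + r y x = 0" for x y z c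
    by (simp_all add: r_def add diff mult algebra_simps)
  note r_simps = r_add r_diff r_scale r_alt
  have vs: "vector_space ((*) :: 'f \<Rightarrow> 'f \<Rightarrow> 'f)"
    using p by (simp add: Vector_Spaces.linear_iff)
  have "bilinear_form scale (\<lambda>u v. r u (a v) + r (a u) v - t * r u v)"
    unfolding bilinear_form_def Vector_Spaces.linear_iff
    by (intro allI conjI vector_space_axioms vs)
      (simp_all add: a_add a_scale r_simps algebra_simps)
  moreover have "r u (a (l u)) + r (a u) (l u) - t * r u (l u) = 0" if "l \<in> L" for l u
    using that
  proof (elim L_E)
    fix c d
    assume "l = (\<lambda>x. scale c x + scale d (a x))"
    \<comment> \<open>Since \<open>r u u = 0\<close>, the coefficient of \<open>c\<close> reduces to
      \<open>r u (a u) + r (a u) u\<close>, zero by \<open>r_skew\<close>. That of \<open>d\<close>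
      is \<open>r u (a (a u)) + r (a u) (a u) - t * r u (a u)\<close>, zero by \<open>a_a\<close>
      and \<open>r_alt\<close>.\<close>
    then show ?thesis
      using r_skew[of u "a u"] by (simp add: a_simps r_simps algebra_simps flip: distrib_left)
  qed
  ultimately show ?thesis by (simp add: W_forms_def)
qed

text \<open>By \<open>line_independent\<close> and \<open>coeffs_zero\<close> the vectors
  \<open>x\<close>, \<open>a x\<close>, \<open>y\<close>, \<open>a y\<close> are linearly
  independent. So there are functionals \<open>p\<close> and \<open>q\<close> that are 1 on
  \<open>x\<close> and on \<open>a y\<close> respectively and vanish on the other three.\<close>

lemma W_forms_separating:
  assumes "x \<noteq> 0" "y \<notin> (\<lambda>l. l x) ` L"
  shows "\<exists>s\<in>W_forms scale L. s x y \<noteq> 0"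
proof -
  have indep: "c = 0 \<and> d = 0 \<and> c' = 0 \<and> d' = 0"
    if "scale c x + scale d (a x) = scale c' y + scale d' (a y)" for c d c' d'
    using line_independent[where l = "\<lambda>x. scale c x + scale d (a x)"
        and m = "\<lambda>x. scale c' x + scale d' (a x)", OF assms L_I L_I that]
      coeffs_zero[of c d, OF _ assms(1)] coeffs_zero[of c' d', OF _ assms(1)]
    by (meson fun_cong)
  have "x \<notin> span {a x, y, a y}"
  proof
    assume "x \<in> span {a x, y, a y}"
    then obtain k1 k2 k3 where "x - scale k1 (a x) - scale k2 y - scale k3 (a y) = 0"
      by (auto simp: span_breakdown_eq)
    then show False using indep[of 1 "- k1" k2 k3] by (simp add: algebra_simps)
  qed
  then obtain p where p: "Vector_Spaces.linear scale (*) p" "p x = 1" "p (a x) = 0" "p y = 0" "p (a y) = 0"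
    by (rule functional_separating) auto
  have "a y \<notin> span {x, a x, y}"
  proof
    assume "a y \<in> span {x, a x, y}"
    then obtain k1 k2 k3 where "a y - scale k1 x - scale k2 (a x) - scale k3 y = 0"
      by (auto simp: span_breakdown_eq)
    then show False using indep[of k1 k2 "- k3" 1] by (simp add: algebra_simps)
  qed
  then obtain q where q: "Vector_Spaces.linear scale (*) q" "q (a y) = 1" "q x = 0" "q (a x) = 0" "q y = 0"
    by (rule functional_separating) auto
  \<comment> \<open>At \<open>(x, y)\<close> the only surviving term is
    \<open>p x * q (a y) = 1\<close>, which comes from \<open>r x (a y)\<close>.\<close>
  from wedge_in_W_forms[OF p(1) q(1)] show ?thesis
    by (rule bexI[rotated]) (simp add: p q)
qed

section \<open>Additive maps preserving every \<open>L\<close>-line\<close>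

text \<open>Vectors on different \<open>L\<close>-lines have the same multiplier, by additivity at
  their sum. Vectors off the line of \<open>x\<^sub>0\<close> are compared with
  \<open>x\<^sub>0\<close>, nonzero vectors on it with \<open>y\<^sub>0\<close>.\<close>

lemma preserving_lines_imp_mem:
  assumes f_add: "\<And>x y. f (x + y) = f x + f y"
    and f_line: "\<And>x. \<exists>l\<in>L. f x = l x"
    and "x\<^sub>0 \<noteq> 0" "y\<^sub>0 \<notin> (\<lambda>l. l x\<^sub>0) ` L"
  shows "f \<in> L"
proof -
  have same: "l = m"
    if "x \<noteq> 0" "y \<notin> (\<lambda>l. l x) ` L" "l \<in> L" "m \<in> L" "f x = l x" "f y = m y" for x y l m
  proof -
    obtain k where k: "k \<in> L" "f (x + y) = k (x + y)"
      using f_line by blast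
    \<comment> \<open>Both sides come from \<open>k x + k y = f (x + y) = l x + m y\<close>;
      independence of the two lines then gives \<open>l = k = m\<close>.\<close>
    have "k x - l x = m y - k y"
      using k that f_add[of x y] L_add[OF k(1), of x y] by (simp add: algebra_simps)
    from line_independent[where l = "\<lambda>x. k x - l x" and m = "\<lambda>x. m x - k x",
        OF that(1,2) L_diff[OF k(1) that(3)] L_diff[OF that(4) k(1)] this]
    have "k x = l x" "m x = k x" for x by (simp_all add: fun_eq_iff)
    then show ?thesis by auto
  qed
  obtain l where l: "l \<in> L" "f x\<^sub>0 = l x\<^sub>0" using f_line by blast
  obtain l' where l': "l' \<in> L" "f y\<^sub>0 = l' y\<^sub>0" using f_line by blast
  have ly: "f y\<^sub>0 = l y\<^sub>0"
    unfolding same[OF assms(3,4) l(1) l'(1) l(2) l'(2)] by (rule l'(2))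
  have "f z = l z" for z
  proof -
    obtain m where m: "m \<in> L" "f z = m z" using f_line by blast
    show ?thesis
    proof (cases "z \<in> (\<lambda>l. l x\<^sub>0) ` L")
      case False
      show ?thesis
        unfolding same[OF assms(3) False l(1) m(1) l(2) m(2)] by (rule m(2))
    next
      case True
      then obtain k where k: "k \<in> L" "z = k x\<^sub>0" by auto
      show ?thesis
      proof (cases "z = 0")
        case True
        then show ?thesis using m L_zero[OF m(1)] L_zero[OF l(1)] by simp
      next
        case False
        \<comment> \<open>As \<open>z = k x\<^sub>0\<close>, the line of \<open>z\<close> is
          contained in that of \<open>x\<^sub>0\<close>, which misses
          \<open>y\<^sub>0\<close>.\<close>
        have "y\<^sub>0 \<notin> (\<lambda>j. j z) ` L"
        proof
          assume "y\<^sub>0 \<in> (\<lambda>j. j z) ` L"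
          then obtain j where j: "j \<in> L" "y\<^sub>0 = j (k x\<^sub>0)" using k(2) by auto
          with assms(4) imageI[OF L_comp[OF j(1) k(1)], of "\<lambda>l. l x\<^sub>0"] show False by simp
        qed
        from same[OF False this m(1) l(1) m(2) ly] show ?thesis using m(2) by simp
      qed
    qed
  qed
  then have "f = l" by auto
  with l show ?thesis by simp
qed

text \<open>Over the ground field the line \<open>L x\<close> is spanned by \<open>x\<close> and
  \<open>a x\<close>, so it cannot fill a space of dimension above 2.\<close>

lemma exists_off_line:
  assumes "dim (UNIV :: 'v set) > 2"
  shows "\<exists>y. y \<notin> (\<lambda>l. l x) ` L"
proof (rule ccontr)
  assume "\<not> ?thesis"
  then have "UNIV \<subseteq> (\<lambda>l. l x) ` L" by auto
  moreover have "(\<lambda>l. l x) ` L \<subseteq> span {x, a x}"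
    by (auto simp: L_eq intro!: span_add span_scale intro: span_base)
  ultimately have "UNIV \<subseteq> span {x, a x}" by (rule subset_trans)
  then have "dim (UNIV :: 'v set) \<le> card {x, a x}"
    by (intro dim_le_card) auto
  also have "\<dots> \<le> 2" by (simp add: card_insert_if)
  finally show False using assms by simp
qed

end

section \<open>A generator for every quadratic extension\<close>

text \<open>A basis \<open>v\<close>, \<open>w\<close> of \<open>L\<close> is exchanged for id and a
  nonscalar \<open>a\<close>, possible because id lies in \<open>L\<close>. Closure under
  composition then yields the quadratic relation.\<close>

lemma quadratic_extension_generator_exists:
  fixes scale :: "'f::field \<Rightarrow> 'v::ab_group_add \<Rightarrow> 'v"
  assumes V: "vector_space scale" and Q: "quadratic_extension scale L"
  shows "\<exists>a t n. quadratic_extension_generator scale a L t n"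
proof -
  interpret vector_space scale by fact
  interpret R: ring "End_ring scale" by (rule ring_End_ring) fact
  note lin = linear_endo_iff[OF V]
  have scal: "scalar_maps scale \<subseteq> L" and sf: "subfield L (End_ring scale)"
    and dim: "R.dimension 2 (scalar_maps scale) L"
    using Q by (auto simp: quadratic_extension_def)
  have LR: "L \<subseteq> carrier (End_ring scale)"
    using subfieldE(3)[OF sf] .
  then have Llin: "l (x + y) = l x + l y" "l (scale c x) = scale c (l x)" if "l \<in> L" for l x y c
    using that by (auto simp: End_ring_simps lin)
  obtain v w where vw: "L = {\<lambda>x. scale c (v x) + scale d (w x) |c d. True}"
    and w: "w \<noteq> (\<lambda>x. 0)" and v: "\<And>c. v \<noteq> (\<lambda>x. scale c (w x))"
  proof -
    \<comment> \<open>Two steps of the inductive predicate \<open>R.dimension\<close> peel off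
      \<open>v\<close> and then \<open>w\<close>, leaving the zero space \<open>E'\<close>.\<close>
    obtain v E where E: "v \<in> carrier (End_ring scale)" "v \<notin> E" "R.dimension 1 (scalar_maps scale) E"
      "L = R.line_extension (scalar_maps scale) v E"
      using dim by (cases rule: R.dimension.cases) auto
    obtain w E' where E': "w \<in> carrier (End_ring scale)" "w \<notin> E'" "R.dimension 0 (scalar_maps scale) E'"
      "E = R.line_extension (scalar_maps scale) w E'"
      using E(3) by (cases rule: R.dimension.cases) auto
    have "E' = {\<lambda>x. 0}"
      using E'(3) by (cases rule: R.dimension.cases) (auto simp: End_ring_simps)
    with E' E have w0: "w \<noteq> (\<lambda>x. 0)" and Eeq: "E = {\<lambda>x. scale c (w x) |c. True}"
      by (auto simp: R.line_extension_def r_coset_def set_add_def set_mult_def End_ring_simps scalar_maps_def o_def)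
    show thesis
    proof (rule that)
      show "L = {\<lambda>x. scale c (v x) + scale d (w x) |c d. True}"
        unfolding E(4) Eeq
        by (auto simp: R.line_extension_def r_coset_def set_add_def set_mult_def End_ring_simps scalar_maps_def o_def)
      show "w \<noteq> (\<lambda>x. 0)" by fact
      show "v \<noteq> (\<lambda>x. scale c (w x))" for c using E(2) Eeq by auto
    qed
  qed
  have id_L: "(\<lambda>x. x) \<in> L"
  proof -
    have "scale 1 \<in> L" using scal by (auto simp: scalar_maps_def)
    moreover have "scale 1 = (\<lambda>x. x)" by auto
    ultimately show ?thesis by simp
  qed
  obtain a where a: "L = {\<lambda>x. scale c x + scale d (a x) |c d. True}" "a \<notin> scalar_maps scale"
  \<comment> \<open>A scalar \<open>w\<close> is a nonzero multiple of id, so \<open>v\<close> can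
    serve as \<open>a\<close>. Otherwise \<open>a\<close> is \<open>w\<close>, and \<open>v\<close>
    is eliminated by solving the expansion of id for it.\<close>
  proof (cases "w \<in> scalar_maps scale")
    case True
    then obtain e where e: "w = scale e" by (auto simp: scalar_maps_def)
    with w have "e \<noteq> 0" by auto
    show thesis
    proof (rule that)
      show "v \<notin> scalar_maps scale"
      proof
        assume "v \<in> scalar_maps scale"
        then obtain k where "v = scale k" by (auto simp: scalar_maps_def)
        with v[of "k / e"] \<open>e \<noteq> 0\<close> show False by (simp add: e fun_eq_iff)
      qed
      have "\<exists>c' d'. (\<lambda>x. scale c (v x) + scale d (w x)) = (\<lambda>x. scale c' x + scale d' (v x))" for c d
        by (rule exI[of _ "d * e"], rule exI[of _ c]) (simp add: e add.commute)
      moreover have "\<exists>c' d'. (\<lambda>x. scale c x + scale d (v x)) = (\<lambda>x. scale c' (v x) + scale d' (w x))" for c d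
        by (rule exI[of _ d], rule exI[of _ "c / e"]) (simp add: \<open>e \<noteq> 0\<close> e add.commute)
      ultimately show "L = {\<lambda>x. scale c x + scale d (v x) |c d. True}"
        unfolding vw by blast
    qed
  next
    case False
    obtain c\<^sub>0 d\<^sub>0 where "(\<lambda>x. x) = (\<lambda>x. scale c\<^sub>0 (v x) + scale d\<^sub>0 (w x))"
      using id_L unfolding vw by blast
    then have id_eq: "x = scale c\<^sub>0 (v x) + scale d\<^sub>0 (w x)" for x
      by (rule fun_cong)
    have "c\<^sub>0 \<noteq> 0"
    proof
      assume "c\<^sub>0 = 0"
      then have d: "x = scale d\<^sub>0 (w x)" for x using id_eq[of x] by simp
      have "w x = scale (inverse d\<^sub>0) x" for x
      proof (cases "d\<^sub>0 = 0")
        case True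
        \<comment> \<open>With both coefficients zero the identity vanishes, so \<open>V\<close> is
          trivial and any two vectors agree.\<close>
        then have "y = 0" for y :: 'v using d[of y] by simp
        then show ?thesis by metis
      next
        case False
        then have "w x = scale (inverse d\<^sub>0) (scale d\<^sub>0 (w x))" by simp
        then show ?thesis by (simp flip: d)
      qed
      then have "w = scale (inverse d\<^sub>0)" by auto
      with False show False by (auto simp: scalar_maps_def)
    qed
    have v_eq: "v x = scale (1 / c\<^sub>0) x + scale (- d\<^sub>0 / c\<^sub>0) (w x)" for x
    proof -
      have "scale (1 / c\<^sub>0) x = scale (1 / c\<^sub>0) (scale c\<^sub>0 (v x) + scale d\<^sub>0 (w x))"
        using id_eq[of x] by simp
      also have "\<dots> = v x + scale (d\<^sub>0 / c\<^sub>0) (w x)"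
        using \<open>c\<^sub>0 \<noteq> 0\<close> by (simp add: scale_right_distrib)
      finally show ?thesis by simp
    qed
    show thesis
    proof (rule that)
      have "\<exists>c' d'. (\<lambda>x. scale c (v x) + scale d (w x)) = (\<lambda>x. scale c' x + scale d' (w x))" for c d
        by (rule exI[of _ "c / c\<^sub>0"], rule exI[of _ "d - c * d\<^sub>0 / c\<^sub>0"])
          (simp add: v_eq scale_right_distrib scale_right_diff_distrib scale_left_diff_distrib fun_eq_iff)
      moreover have "\<exists>c' d'. (\<lambda>x. scale c x + scale d (w x)) = (\<lambda>x. scale c' (v x) + scale d' (w x))" for c d
        by (rule exI[of _ "c * c\<^sub>0"], rule exI[of _ "d + c * d\<^sub>0"])
          (simp add: \<open>c\<^sub>0 \<noteq> 0\<close> v_eq scale_right_distrib scale_right_diff_distrib scale_left_distrib)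
      ultimately show "L = {\<lambda>x. scale c x + scale d (w x) |c d. True}"
        unfolding vw by blast
    qed fact
  qed
  have aL: "a \<in> L"
    unfolding a(1) by (intro CollectI, rule exI[of _ 0], rule exI[of _ 1]) simp
  have "a \<circ> a \<in> L"
    using subringE(6)[OF subfieldE(1)[OF sf] aL aL] by (simp add: End_ring_simps)
  then obtain c d where "a \<circ> a = (\<lambda>x. scale c x + scale d (a x))"
    unfolding a(1) by blast
  then have aa: "a (a x) = scale c x + scale d (a x)" for x
    by (metis comp_apply)
  have inv: "\<exists>m\<in>L. \<forall>x. m (l x) = x" if "l \<in> L" "l \<noteq> (\<lambda>x. 0)" for l
    using R.subfield_m_inv(1,3)[OF sf, of l] that
    by (auto simp: End_ring_simps fun_eq_iff)
  \<comment> \<open>The sign matches the convention \<open>t a - n\<close> of \<open>a_a\<close>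
    with \<open>a (a x) = scale c x + scale d (a x)\<close>.\<close>
  have "quadratic_extension_generator scale a L d (- c)"
    by unfold_locales (fact a | simp add: aa Llin[OF aL] add.commute | erule (1) inv)+
  then show ?thesis by blast
qed

section \<open>Equality of the two extensions\<close>

theorem proposition1p8:
  fixes scale :: "'f::field \<Rightarrow> 'v::ab_group_add \<Rightarrow> 'v"
    and Basis :: "'v set"
    and L L' :: "('v \<Rightarrow> 'v) set"
  assumes "finite_dimensional_vector_space scale Basis"
    and "vector_space.dim scale (UNIV :: 'v set) \<ge> 4"
    and "quadratic_extension scale L"
    and "quadratic_extension scale L'"
    and "W_forms scale L = W_forms scale L'"
  shows "L = L'"
proof -
  interpret finite_dimensional_vector_space scale Basis by fact
  have V: "vector_space scale" by unfold_locales
  have sub: "M' \<subseteq> M"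
    if Q: "quadratic_extension scale M" and Q': "quadratic_extension scale M'"
      and W: "W_forms scale M = W_forms scale M'" for M M'
  proof
    fix f assume f: "f \<in> M'"
    obtain a t n where "quadratic_extension_generator scale a M t n"
      using quadratic_extension_generator_exists[OF V Q] by blast
    then interpret G: quadratic_extension_generator scale a M t n .
    obtain a' t' n' where "quadratic_extension_generator scale a' M' t' n'"
      using quadratic_extension_generator_exists[OF V Q'] by blast
    then interpret G': quadratic_extension_generator scale a' M' t' n' .
    have line: "\<exists>l\<in>M. f x = l x" for x
    proof (cases "x = 0")
      case True
      then show ?thesis using G.L_I G.L_zero G'.L_zero[OF f] by metis
    next
      case False
      show ?thesis
      proof (rule ccontr)
        assume "\<not> ?thesis"
        then obtain s where "s \<in> W_forms scale M" "s x (f x) \<noteq> 0"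
          using G.W_forms_separating[OF False, of "f x"] by blast
        \<comment> \<open>By \<open>W\<close>, \<open>s\<close> also lies in
          \<open>W_forms scale M'\<close>, so \<open>f\<close> in \<open>M'\<close> forces
          \<open>s x (f x) = 0\<close>.\<close>
        with W f show False by (auto simp: W_forms_def)
      qed
    qed
    have dim: "dim (UNIV :: 'v set) > 2" using assms(2) by simp
    \<comment> \<open>The line of 0 contains 0, so a vector off it is nonzero.\<close>
    obtain x\<^sub>0 where "x\<^sub>0 \<notin> (\<lambda>l. l 0) ` M"
      using G.exists_off_line[OF dim] by blast
    then have "x\<^sub>0 \<noteq> 0"
      using imageI[OF G.L_I[of 0 0], of "\<lambda>l. l 0"] by auto
    moreover obtain y\<^sub>0 where "y\<^sub>0 \<notin> (\<lambda>l. l x\<^sub>0) ` M"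
      using G.exists_off_line[OF dim] by blast
    ultimately show "f \<in> M"
      by (intro G.preserving_lines_imp_mem G'.L_add[OF f] line)
  qed
  show ?thesis using sub[OF assms(3-5)] sub[OF assms(4,3) assms(5)[symmetric]] by (rule equalityI[rotated])
qed

end
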